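(* Let $d\geq 2$, let $H$ be an order $d$ complex Hadamard matrix and let $v\in\mathbb{C}$. Then $H(v)$ is a set of $d^2$ equiangular lines in $\mathbb{C}^d$ if and only if one of the following holds: (1) $d=2$ and $v\in\left\{\frac{1}{2}(1\pm\sqrt{3})(1+i),\ \frac{1}{2}(1\pm\sqrt{3})(1-i),\ -\frac{1}{2}(1\pm\sqrt{3})(1+i),\ -\frac{1}{2}(1\pm\sqrt{3})(1-i)\right\}$; (2) $d=3$ and $v\in\{0,-2,1\pm\sqrt{3}\,i\}$; (3) $d=8$, $H$ is equivalent to a real Hadamard matrix, and $v\in\{-1\pm 2i\}$.
   Context: An order $d$ complex Hadamard matrix is a $d\times d$ matrix $H$ with all entries in $\mathbb{C}$ of magnitude $1$ such that $HH^\dagger = dI_d$, where $H^\dagger$ is the conjugate transpose. If all entries lie in $\{1,-1\}$, $H$ is a real Hadamard matrix. Two complex Hadamard matrices $H,H'$ are equivalent if $H'=DPHP'D'$ for some diagonal unitary matrices $D,D'$ and permutation matrices $P,P'$. Construction: regard the $d$ rows of $H$ as vectors in $\mathbb{C}^d$. For $j=1,\dots,d$ let $H_j(v)$ be the collection of $d$ vectors obtained by multiplying coordinate $j$ of each row of $H$ by $v$, and let $H(v)=\bigcup_{j=1}^d H_j(v)$, a collection of $d^2$ vectors (all of the same norm). Using the standard Hermitian inner product $\langle\cdot,\cdot\rangle$ on $\mathbb{C}^d$, "$H(v)$ is a set of $d^2$ equiangular lines" means that these $d^2$ vectors span $d^2$ distinct lines through the origin and there is a constant $c$ with $|\langle \mathbf{x},\mathbf{y}\rangle|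 = c$ for every pair of distinct vectors $\mathbf{x},\mathbf{y}$ of $H(v)$. *)

theory Defs
  imports "HOL-Analysis.Analysis"
begin

definition conj_transpose :: "complex ^ 'n ^ 'm \<Rightarrow> complex ^ 'm ^ 'n" where
  "conj_transpose A = (\<chi> i j. cnj (A $ j $ i))"

definition hermitian_inner :: "complex ^ 'n \<Rightarrow> complex ^ 'n \<Rightarrow> complex" where
  "hermitian_inner x y = (\<Sum>k\<in>UNIV. x $ k * cnj (y $ k))"

definition complex_hadamard :: "complex ^ 'n ^ 'n \<Rightarrow> bool" where
  "complex_hadamard H \<longleftrightarrow>
     (\<forall>i j. cmod (H $ i $ j) = 1) \<and> H ** conj_transpose H = mat (of_nat CARD('n))"

definition real_hadamard :: "complex ^ 'n ^ 'n \<Rightarrow> bool" where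
  "real_hadamard H \<longleftrightarrow> complex_hadamard H \<and> (\<forall>i j. H $ i $ j \<in> {1, -1})"

definition diagonal_unitary :: "complex ^ 'n ^ 'n \<Rightarrow> bool" where
  "diagonal_unitary D \<longleftrightarrow>
     (\<forall>i j. i \<noteq> j \<longrightarrow> D $ i $ j = 0) \<and>
     D ** conj_transpose D = mat 1 \<and> conj_transpose D ** D = mat 1"

definition permutation_matrix :: "complex ^ 'n ^ 'n \<Rightarrow> bool" where
  "permutation_matrix P \<longleftrightarrow>
     (\<exists>p. p permutes (UNIV :: 'n set) \<and> P = (\<chi> i j. if j = p i then 1 else 0))"

definition hadamard_equiv :: "complex ^ 'n ^ 'n \<Rightarrow> complex ^ 'n ^ 'n \<Rightarrow> bool" where
  "hadamard_equiv H H' \<longleftrightarrow>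
     (\<exists>D D' P P'. diagonal_unitary D \<and> diagonal_unitary D' \<and>
        permutation_matrix P \<and> permutation_matrix P' \<and>
        H' = D ** P ** H ** P' ** D')"

definition scale_coord :: "'n \<Rightarrow> complex \<Rightarrow> complex ^ 'n \<Rightarrow> complex ^ 'n" where
  "scale_coord j v x = (\<chi> k. if k = j then v * x $ k else x $ k)"

text \<open>The collections \<open>H\<^sub>j(v)\<close> and \<open>H(v)\<close> are taken as sets. Should two of
  the \<open>d\<^sup>2\<close> vectors coincide, the cardinality condition in \<open>equiangular_lines\<close>
  fails, as it should, since the collection then spans fewer than \<open>d\<^sup>2\<close> lines.\<close>

definition hadamard_vecs_at :: "complex ^ 'n ^ 'n \<Rightarrow> 'n \<Rightarrow> complex \<Rightarrow> (complex ^ 'n) set" where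
  "hadamard_vecs_at H j v = scale_coord j v ` rows H"

definition hadamard_vecs :: "complex ^ 'n ^ 'n \<Rightarrow> complex \<Rightarrow> (complex ^ 'n) set" where
  "hadamard_vecs H v = (\<Union>j\<in>UNIV. hadamard_vecs_at H j v)"

text \<open>\<open>vec.span\<close> is the span over the complex numbers (plain \<open>span\<close> would be the real one).
  The inner products are not normalised: the notion is meant for vectors of equal norm.\<close>

definition equiangular_lines :: "nat \<Rightarrow> (complex ^ 'n) set \<Rightarrow> bool" where
  "equiangular_lines N S \<longleftrightarrow>
     0 \<notin> S \<and> card S = N \<and> card ((\<lambda>x. vec.span {x}) ` S) = N \<and>
     (\<exists>c. \<forall>x\<in>S. \<forall>y\<in>S. x \<noteq> y \<longrightarrow> cmod (hermitian_inner x y) = c)"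

end

theory Submission
  imports Defs
begin

text \<open>Write \<open>w = v - 1\<close> and, for two rows \<open>r \<noteq> s\<close>, \<open>u\<^sub>j = H\<^sub>r\<^sub>j cnj H\<^sub>s\<^sub>j\<close>; these are unit
  complex numbers with sum 0. The inner products of distinct vectors are
  \<open>(|v|\<^sup>2 - 1) u\<^sub>j\<close>, \<open>d - 2 + 2 Re v\<close> and \<open>w u\<^sub>j + cnj w u\<^sub>k\<close>, so everything depends on the
  numbers \<open>Re (w\<^sup>2 u\<^sub>j cnj u\<^sub>k)\<close> being constant. Exchanging \<open>j\<close> and \<open>k\<close> shows that \<open>w\<^sup>2\<close> is real
  or all \<open>u\<^sub>j cnj u\<^sub>k\<close> are. If \<open>w\<^sup>2\<close> is real, the \<open>u\<^sub>j\<close> form a regular simplex in the plane,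
  so \<open>d \<le> 3\<close>. Otherwise, for \<open>d \<ge> 4\<close>, \<open>H\<close> is equivalent to a real matrix and both signs occur
  among the \<open>u\<^sub>j cnj u\<^sub>k\<close>, so \<open>Re w\<^sup>2 = 0\<close>, which leaves only \<open>d = 8\<close>.\<close>

section \<open>Phase products of two rows in two columns\<close>

text \<open>This is \<open>u\<^sub>j cnj u\<^sub>k\<close> in the notation above. Multiplying rows
  or columns of \<open>H\<close> by phases leaves it unchanged, so it both enters the inner products
  and detects equivalence to a real matrix.\<close>

definition cross :: "complex ^ 'n ^ 'n \<Rightarrow> 'n \<Rightarrow> 'n \<Rightarrow> 'n \<Rightarrow> 'n \<Rightarrow> complex" where
  "cross H r s j k = H $ r $ j * cnj (H $ s $ j) * cnj (H $ r $ k) * H $ s $ k"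

abbreviation hadamard_vec :: "complex ^ 'n ^ 'n \<Rightarrow> complex \<Rightarrow> 'n \<Rightarrow> 'n \<Rightarrow> complex ^ 'n" where
  "hadamard_vec H v r j \<equiv> scale_coord j v (row r H)"

lemma hadamard_norm: "complex_hadamard H \<Longrightarrow> cmod (H $ i $ j) = 1"
  by (simp add: complex_hadamard_def)

lemma unit_mult_cnj: "cmod z = 1 \<Longrightarrow> z * cnj z = 1"
  by (metis complex_norm_square mult_1 of_real_1 power2_eq_square)

lemma hadamard_mult_cnj: "complex_hadamard H \<Longrightarrow> H $ i $ j * cnj (H $ i $ j) = 1"
  by (simp add: hadamard_norm unit_mult_cnj)

lemma hadamard_row_inner:
  fixes H :: "complex ^ 'n ^ 'n"
  assumes "complex_hadamard H"
  shows "(\<Sum>k\<in>UNIV. H $ r $ k * cnj (H $ s $ k)) = (if r = s then of_nat CARD('n) else 0)"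
proof -
  have "(H ** conj_transpose H) $ r $ s = (mat (of_nat CARD('n)) :: complex ^ 'n ^ 'n) $ r $ s"
    using assms by (simp add: complex_hadamard_def)
  then show ?thesis
    by (simp add: matrix_matrix_mult_def conj_transpose_def mat_def)
qed

lemma cmod_cross: "complex_hadamard H \<Longrightarrow> cmod (cross H r s j k) = 1"
  by (simp add: cross_def norm_mult hadamard_norm)

lemma cross_swap_columns: "cross H r s k j = cnj (cross H r s j k)"
  by (simp add: cross_def mult_ac)

lemma cross_same_column:
  assumes "complex_hadamard H" shows "cross H r s j j = 1"
  using hadamard_mult_cnj[OF assms, of r j] hadamard_mult_cnj[OF assms, of s j]
  unfolding cross_def by algebra

lemma cross_same_row:
  assumes "complex_hadamard H" shows "cross H r r j k = 1"
  using hadamard_mult_cnj[OF assms, of r j] hadamard_mult_cnj[OF assms, of r k]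
  unfolding cross_def by algebra

lemma cross_columns_trans:
  assumes "complex_hadamard H"
  shows "cross H r s j k * cnj (cross H r s l k) = cross H r s j l"
  using hadamard_mult_cnj[OF assms, of r k] hadamard_mult_cnj[OF assms, of s k]
  unfolding cross_def complex_cnj_mult complex_cnj_cnj by algebra

text \<open>Row \<open>i\<close> serves as a reference row that cancels. This is what later makes
  the matrix of cross values relative to a fixed row and column a Hadamard matrix.\<close>

lemma cross_rows_trans:
  assumes "complex_hadamard H"
  shows "cross H r i j k * cnj (cross H s i j k) = cross H r s j k"
  using hadamard_mult_cnj[OF assms, of i j] hadamard_mult_cnj[OF assms, of i k]
  unfolding cross_def complex_cnj_mult complex_cnj_cnj by algebra

lemma sum_cross:
  fixes H :: "complex ^ 'n ^ 'n"
  assumes "complex_hadamard H" "r \<noteq> s"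
  shows "(\<Sum>j\<in>UNIV. cross H r s j k) = 0"
proof -
  have "(\<Sum>j\<in>UNIV. cross H r s j k) =
      (\<Sum>j\<in>UNIV. H $ r $ j * cnj (H $ s $ j)) * (cnj (H $ r $ k) * H $ s $ k)"
    by (simp add: cross_def sum_distrib_right mult.assoc)
  then show ?thesis
    by (simp add: hadamard_row_inner[OF assms(1)] assms(2))
qed

section \<open>Inner products of the scaled rows\<close>

text \<open>Only the term of coordinate \<open>j\<close> differs from the inner product of the
  unscaled rows: it is multiplied by \<open>v * cnj v\<close>. The result is written as that inner
  product plus a correction.\<close>

lemma hermitian_inner_hadamard_vec_same:
  fixes H :: "complex ^ 'n ^ 'n"
  assumes "complex_hadamard H"
  shows "hermitian_inner (hadamard_vec H v r j) (hadamard_vec H v s j) =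
    (if r = s then of_nat CARD('n) else 0)
      + of_real ((cmod v)\<^sup>2 - 1) * (H $ r $ j * cnj (H $ s $ j))"
proof -
  have "hermitian_inner (hadamard_vec H v r j) (hadamard_vec H v s j) =
     (\<Sum>k\<in>UNIV. H $ r $ k * cnj (H $ s $ k) +
        (if k = j then of_real ((cmod v)\<^sup>2 - 1) * (H $ r $ k * cnj (H $ s $ k)) else 0))"
    unfolding hermitian_inner_def
    by (rule sum.cong) (auto simp: scale_coord_def row_def algebra_simps complex_norm_square
        simp flip: of_real_power)
  then show ?thesis
    by (simp add: sum.distrib hadamard_row_inner[OF assms])
qed

lemma hermitian_inner_hadamard_vec_diff:
  fixes H :: "complex ^ 'n ^ 'n"
  assumes "complex_hadamard H" "j \<noteq> k"
  shows "hermitian_inner (hadamard_vec H v r j) (hadamard_vec H v s k) =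
    (if r = s then of_nat CARD('n) else 0)
      + (v - 1) * (H $ r $ j * cnj (H $ s $ j)) + (cnj v - 1) * (H $ r $ k * cnj (H $ s $ k))"
proof -
  have "hermitian_inner (hadamard_vec H v r j) (hadamard_vec H v s k) =
     (\<Sum>l\<in>UNIV. H $ r $ l * cnj (H $ s $ l) +
        (if l = j then (v - 1) * (H $ r $ l * cnj (H $ s $ l)) else 0) +
        (if l = k then (cnj v - 1) * (H $ r $ l * cnj (H $ s $ l)) else 0))"
    unfolding hermitian_inner_def
    by (rule sum.cong) (use assms(2) in \<open>auto simp: scale_coord_def row_def algebra_simps\<close>)
  then show ?thesis
    by (simp add: sum.distrib hadamard_row_inner[OF assms(1)])
qed

lemma hermitian_inner_hadamard_vec_self:
  fixes H :: "complex ^ 'n ^ 'n"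
  assumes "complex_hadamard H"
  shows "hermitian_inner (hadamard_vec H v r j) (hadamard_vec H v r j) =
    of_real (of_nat CARD('n) - 1 + (cmod v)\<^sup>2)"
  by (simp add: hermitian_inner_hadamard_vec_same[OF assms] hadamard_mult_cnj[OF assms])

lemma cmod_hadamard_vec_same_column:
  fixes H :: "complex ^ 'n ^ 'n"
  assumes "complex_hadamard H" "r \<noteq> s"
  shows "cmod (hermitian_inner (hadamard_vec H v r j) (hadamard_vec H v s j)) = \<bar>(cmod v)\<^sup>2 - 1\<bar>"
  using assms(2)
  by (simp add: hermitian_inner_hadamard_vec_same[OF assms(1)] norm_mult hadamard_norm[OF assms(1)]
      del: of_real_diff of_real_power)

lemma cmod_hadamard_vec_same_row:
  fixes H :: "complex ^ 'n ^ 'n"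
  assumes "complex_hadamard H" "j \<noteq> k"
  shows "cmod (hermitian_inner (hadamard_vec H v r j) (hadamard_vec H v r k)) =
    \<bar>real CARD('n) - 2 + 2 * Re v\<bar>"
proof -
  have "hermitian_inner (hadamard_vec H v r j) (hadamard_vec H v r k) =
      of_real (real CARD('n) - 2 + 2 * Re v)"
    by (simp add: hermitian_inner_hadamard_vec_diff[OF assms] hadamard_mult_cnj[OF assms(1)]
        complex_eq_iff)
  then show ?thesis
    by (simp only: norm_of_real)
qed

text \<open>The coefficients are conjugate to each other, so the mixed terms of the expansion are
  \<open>w\<^sup>2 * (a * cnj b)\<close> and its conjugate. Hence the argument of \<open>w\<close>
  matters, not only its modulus.\<close>

lemma cmod_square_add_cnj:
  assumes "cmod a = 1" "cmod b = 1"
  shows "(cmod (w * a + cnj w * b))\<^sup>2 = 2 * (cmod w)\<^sup>2 + 2 * Re (w\<^sup>2 * (a * cnj b))"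
proof -
  have a: "a * cnj a = 1" and b: "b * cnj b = 1"
    using assms by (simp_all add: unit_mult_cnj)
  have "complex_of_real ((cmod (w * a + cnj w * b))\<^sup>2) =
      (w * a + cnj w * b) * (cnj w * cnj a + w * cnj b)"
    by (simp only: complex_norm_square complex_cnj_add complex_cnj_mult complex_cnj_cnj)
  also have "\<dots> = 2 * (w * cnj w) + (w\<^sup>2 * (a * cnj b) + cnj (w\<^sup>2 * (a * cnj b)))"
    unfolding complex_cnj_add complex_cnj_mult complex_cnj_cnj complex_cnj_power
    using a b by algebra
  also have "\<dots> = of_real (2 * (cmod w)\<^sup>2 + 2 * Re (w\<^sup>2 * (a * cnj b)))"
    by (simp only: complex_add_cnj complex_norm_square[symmetric]) simp
  finally show ?thesis
    by (simp only: of_real_eq_iff)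
qed

lemma cmod_hadamard_vec_diff_row_column:
  fixes H :: "complex ^ 'n ^ 'n"
  assumes "complex_hadamard H" "j \<noteq> k" "r \<noteq> s"
  shows "(cmod (hermitian_inner (hadamard_vec H v r j) (hadamard_vec H v s k)))\<^sup>2 =
    2 * (cmod (v - 1))\<^sup>2 + 2 * Re ((v - 1)\<^sup>2 * cross H r s j k)"
  using assms(3)
    cmod_square_add_cnj[of "H $ r $ j * cnj (H $ s $ j)" "H $ r $ k * cnj (H $ s $ k)" "v - 1"]
  by (simp add: hermitian_inner_hadamard_vec_diff[OF assms(1,2)] norm_mult
      hadamard_norm[OF assms(1)] cross_def mult.assoc)

section \<open>Equiangularity as numerical conditions\<close>

lemma hadamard_vecs_eq:
  "hadamard_vecs H v = (\<lambda>(r, j). hadamard_vec H v r j) ` UNIV"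
  unfolding hadamard_vecs_def hadamard_vecs_at_def rows_def by auto

text \<open>Vectors of equal norm on one line differ by a unit factor, the equality case of
  Cauchy-Schwarz. Its use is to separate lines: a common modulus other than the squared norm
  \<open>N\<close> rules out coincidences.\<close>

lemma cmod_hermitian_inner_same_line:
  assumes "vec.span {x} = vec.span {y}" "hermitian_inner x x = of_real N"
    "hermitian_inner y y = of_real N" "N > 0"
  shows "cmod (hermitian_inner x y) = N"
proof -
  have "x \<in> vec.span {y}"
    using assms(1) vec.span_base by blast
  then obtain l where x: "x = l *s y"
    by (auto simp: vec.span_singleton)
  have xy: "hermitian_inner x y = l * of_real N"
    unfolding assms(3)[symmetric] x by (simp add: hermitian_inner_def sum_distrib_left mult.assoc)
  have "hermitian_inner x x = l * cnj l * of_real N"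
    unfolding assms(3)[symmetric] x
    by (simp add: hermitian_inner_def sum_distrib_left mult_ac)
  then have "l * cnj l = 1"
    using assms(2,4) by simp
  then have "cmod l = 1"
    by (metis complex_mod_sqrt_Re_mult_cnj one_complex.sel(1) real_sqrt_one)
  then show ?thesis
    using xy assms(4) by (simp add: norm_mult)
qed

lemma ex_neq_pair:
  assumes "CARD('n) \<ge> 2"
  obtains r s :: "'n::finite" where "r \<noteq> s"
proof -
  obtain T :: "'n set" where "card T = 2"
    using obtain_subset_with_card_n[OF assms] by metis
  then show thesis
    using that by (auto simp: card_2_iff)
qed

text \<open>The common modulus is taken to be the one for vectors from the same row. The last
  condition compares squares, which avoids the square root in the modulus for different rows and
  columns.\<close>

definition equiangular_conditions :: "complex ^ 'n ^ 'n \<Rightarrow> complex \<Rightarrow> bool" where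
  "equiangular_conditions H v \<longleftrightarrow>
    \<bar>(cmod v)\<^sup>2 - 1\<bar> = \<bar>real CARD('n) - 2 + 2 * Re v\<bar> \<and>
    (\<forall>r s j k. r \<noteq> s \<longrightarrow> j \<noteq> k \<longrightarrow>
      2 * (cmod (v - 1))\<^sup>2 + 2 * Re ((v - 1)\<^sup>2 * cross H r s j k) = (real CARD('n) - 2 + 2 * Re v)\<^sup>2)"

lemma equiangular_lines_iff:
  fixes H :: "complex ^ 'n ^ 'n"
  assumes d: "CARD('n) \<ge> 2" and H: "complex_hadamard H"
  shows "equiangular_lines (CARD('n)\<^sup>2) (hadamard_vecs H v) \<longleftrightarrow> equiangular_conditions H v"
proof
  let ?x = "\<lambda>(r, j). hadamard_vec H v r j"
  assume L: "equiangular_lines (CARD('n)\<^sup>2) (hadamard_vecs H v)"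
  \<comment> \<open>The set has as many elements as there are index pairs, so different pairs give
    different vectors and the constant applies to all of them.\<close>
  have "card (?x ` UNIV) = card (UNIV :: ('n \<times> 'n) set)"
    using L by (simp add: equiangular_lines_def hadamard_vecs_eq card_cartesian_product power2_eq_square
        flip: UNIV_Times_UNIV)
  then have inj: "inj ?x"
    by (simp add: eq_card_imp_inj_on)
  obtain c where "\<forall>x\<in>hadamard_vecs H v. \<forall>y\<in>hadamard_vecs H v.
      x \<noteq> y \<longrightarrow> cmod (hermitian_inner x y) = c"
    using L unfolding equiangular_lines_def by auto
  then have c: "cmod (hermitian_inner (hadamard_vec H v r j) (hadamard_vec H v s k)) = c"
    if "(r, j) \<noteq> (s, k)" for r s j k
    using that injD[OF inj, of "(r, j)" "(s, k)"] by (auto simp: hadamard_vecs_eq)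
  \<comment> \<open>Rows and columns share the index type, so this pair also serves as a pair of
    columns.\<close>
  obtain r s :: 'n where rs: "r \<noteq> s"
    using ex_neq_pair[OF d] .
  have c1: "\<bar>(cmod v)\<^sup>2 - 1\<bar> = c"
    using cmod_hadamard_vec_same_column[OF H rs] c[of r r s r] rs by simp
  have c2: "\<bar>real CARD('n) - 2 + 2 * Re v\<bar> = c"
    using cmod_hadamard_vec_same_row[OF H rs] c[of r r r s] rs by simp
  have "2 * (cmod (v - 1))\<^sup>2 + 2 * Re ((v - 1)\<^sup>2 * cross H r s j k) = (real CARD('n) - 2 + 2 * Re v)\<^sup>2"
    if "r \<noteq> s" "j \<noteq> k" for r s j k
    using cmod_hadamard_vec_diff_row_column[OF H that(2,1), of v] c[of r j s k] that
    by (simp flip: c2)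
  with c1 c2 show "equiangular_conditions H v"
    unfolding equiangular_conditions_def by simp
next
  let ?x = "\<lambda>(r, j). hadamard_vec H v r j"
  let ?c = "\<bar>real CARD('n) - 2 + 2 * Re v\<bar>"
  let ?N = "real CARD('n) - 1 + (cmod v)\<^sup>2"
  assume C: "equiangular_conditions H v"
  then have C1: "\<bar>(cmod v)\<^sup>2 - 1\<bar> = ?c"
    by (simp add: equiangular_conditions_def)
  have c: "cmod (hermitian_inner (hadamard_vec H v r j) (hadamard_vec H v s k)) = ?c"
    if ne: "(r, j) \<noteq> (s, k)" for r s j k
  proof (cases "r = s \<or> j = k")
    case True
    then show ?thesis
      using ne C1 cmod_hadamard_vec_same_column[OF H] cmod_hadamard_vec_same_row[OF H] by auto
  next
    case False
    then have "(cmod (hermitian_inner (hadamard_vec H v r j) (hadamard_vec H v s k)))\<^sup>2 = ?c\<^sup>2"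
      using C cmod_hadamard_vec_diff_row_column[OF H, of j k r s v]
      by (simp add: equiangular_conditions_def)
    then show ?thesis
      by (simp only: power2_eq_iff_nonneg norm_ge_zero abs_ge_zero)
  qed
  have N: "?N > 0"
    using d by (intro add_pos_nonneg) auto
  \<comment> \<open>If they were equal, \<open>C1\<close> would give
    \<open>\<bar>t - 1\<bar> = d - 1 + t\<close> with \<open>t = (cmod v)\<^sup>2\<close>. For
    \<open>d\<close> at least 2 this leaves only \<open>t = 0\<close> and \<open>d = 2\<close>,
    where \<open>C1\<close> reads \<open>1 = 0\<close>.\<close>
  have cN: "?c \<noteq> ?N"
  proof
    assume eq: "?c = ?N"
    have "(cmod v)\<^sup>2 \<ge> 0" "real CARD('n) \<ge> 2"
      using d by simp_all
    then have v: "(cmod v)\<^sup>2 = 0" and "real CARD('n) = 2"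
      using eq C1 by linarith+
    then show False
      using C1 by simp
  qed
  have inj: "inj (\<lambda>i. vec.span {?x i})"
  proof (rule injI, rule ccontr)
    fix a b :: "'n \<times> 'n"
    assume "vec.span {?x a} = vec.span {?x b}" "a \<noteq> b"
    moreover obtain r j s k where "a = (r, j)" "b = (s, k)"
      by (cases a; cases b)
    ultimately show False
      using cmod_hermitian_inner_same_line[of "hadamard_vec H v r j" "hadamard_vec H v s k" ?N]
        hermitian_inner_hadamard_vec_self[OF H] N c[of r j s k] cN by simp
  qed
  then have inj': "inj ?x"
    unfolding inj_def by metis
  have card: "card (UNIV :: ('n \<times> 'n) set) = CARD('n)\<^sup>2"
    by (simp add: card_cartesian_product power2_eq_square flip: UNIV_Times_UNIV)
  have "hadamard_vec H v r j \<noteq> 0" for r j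
  proof
    assume "hadamard_vec H v r j = 0"
    then have "of_real ?N = hermitian_inner (0 :: complex ^ 'n) 0"
      using hermitian_inner_hadamard_vec_self[OF H, where v = v and r = r and j = j] by simp
    also have "\<dots> = of_real 0"
      by (simp add: hermitian_inner_def)
    finally show False
      using N by (simp only: of_real_eq_iff)
  qed
  then have "0 \<notin> hadamard_vecs H v"
    by (auto simp: hadamard_vecs_eq)
  moreover have "card (hadamard_vecs H v) = CARD('n)\<^sup>2"
    unfolding hadamard_vecs_eq card[symmetric] by (rule card_image[OF inj'])
  moreover have "card ((\<lambda>x. vec.span {x}) ` hadamard_vecs H v) = CARD('n)\<^sup>2"
    unfolding hadamard_vecs_eq card[symmetric] image_image by (rule card_image[OF inj])
  moreover have "\<forall>x\<in>hadamard_vecs H v. \<forall>y\<in>hadamard_vecs H v.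
      x \<noteq> y \<longrightarrow> cmod (hermitian_inner x y) = ?c"
  proof (clarsimp simp only: hadamard_vecs_eq image_iff split: prod.splits)
    fix r j s k
    assume "hadamard_vec H v r j \<noteq> hadamard_vec H v s k"
    then show "cmod (hermitian_inner (hadamard_vec H v r j) (hadamard_vec H v s k)) = ?c"
      by (intro c) auto
  qed
  ultimately show "equiangular_lines (CARD('n)\<^sup>2) (hadamard_vecs H v)"
    unfolding equiangular_lines_def by blast
qed

section \<open>Dimensions two and three\<close>

lemma cross_two:
  fixes H :: "complex ^ 'n ^ 'n"
  assumes "complex_hadamard H" "CARD('n) = 2" "r \<noteq> s" "j \<noteq> k"
  shows "cross H r s j k = -1"
proof -
  have "{j, k} = UNIV"
    by (rule card_seteq) (use assms in auto)
  then have "(\<Sum>l\<in>{j, k}. cross H r s l k) = 0"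
    using sum_cross[OF assms(1,3)] by simp
  then show ?thesis
    using assms(4) by (simp add: cross_same_column[OF assms(1)] add_eq_0_iff2)
qed

text \<open>The cross values of the three columns against column \<open>k\<close> are unit numbers
  with sum 0, one of them being 1. So \<open>1 + z\<close> is a unit number for
  \<open>z = cross H r s j k\<close>, and its squared modulus is
  \<open>2 + 2 * Re z\<close>.\<close>

lemma Re_cross_three:
  fixes H :: "complex ^ 'n ^ 'n"
  assumes "complex_hadamard H" "CARD('n) = 3" "r \<noteq> s" "j \<noteq> k"
  shows "Re (cross H r s j k) = -1/2"
proof -
  have "{j, k} \<noteq> UNIV"
    using assms(2,4) by (metis card_2_iff numeral_eq_iff semiring_norm(89))
  then obtain l where l: "l \<noteq> j" "l \<noteq> k"
    by blast
  have "{j, k, l} = UNIV"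
    by (rule card_seteq) (use assms l in auto)
  then have "(\<Sum>i\<in>{j, k, l}. cross H r s i k) = 0"
    using sum_cross[OF assms(1,3)] by simp
  then have "cross H r s l k = - (1 + cross H r s j k)"
    using assms(4) l by (simp add: cross_same_column[OF assms(1)] eq_neg_iff_add_eq_0 add_ac del: minus_add_distrib)
  then have "(cmod (1 + cross H r s j k))\<^sup>2 = 1"
    using cmod_cross[OF assms(1), of r s l k] by (simp only: norm_minus_cancel) simp
  moreover have "(cmod (cross H r s j k))\<^sup>2 = 1"
    by (simp add: cmod_cross[OF assms(1)])
  ultimately show ?thesis
    unfolding cmod_power2 by (simp add: power2_eq_square algebra_simps)
qed

text \<open>All cross values are -1, so the mixed condition collapses to
  \<open>y\<^sup>2 = x\<^sup>2\<close>. The other condition then splits into two quadratics in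
  \<open>x\<close>; their four roots with two signs of \<open>y\<close> give the eight
  values.\<close>

lemma equiangular_conditions_two:
  fixes H :: "complex ^ 'n ^ 'n"
  assumes H: "complex_hadamard H" and d: "CARD('n) = 2"
  shows "equiangular_conditions H v \<longleftrightarrow>
    v \<in> {1/2 * (1 + of_real (sqrt 3)) * (1 + \<i>), 1/2 * (1 - of_real (sqrt 3)) * (1 + \<i>),
         1/2 * (1 + of_real (sqrt 3)) * (1 - \<i>), 1/2 * (1 - of_real (sqrt 3)) * (1 - \<i>),
         - (1/2) * (1 + of_real (sqrt 3)) * (1 + \<i>), - (1/2) * (1 - of_real (sqrt 3)) * (1 + \<i>),
         - (1/2) * (1 + of_real (sqrt 3)) * (1 - \<i>), - (1/2) * (1 - of_real (sqrt 3)) * (1 - \<i>)}"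
    (is "_ \<longleftrightarrow> v \<in> ?S")
proof -
  define x y where "x = Re v" and "y = Im v"
  have 1: "2 * (cmod (v - 1))\<^sup>2 + 2 * Re ((v - 1)\<^sup>2 * (-1)) = (real 2 - 2 + 2 * Re v)\<^sup>2 \<longleftrightarrow>
      y\<^sup>2 = x\<^sup>2"
    by (simp add: cmod_power2 x_def y_def) (simp add: power2_eq_square algebra_simps)
  obtain r s :: 'n where "r \<noteq> s"
    using ex_neq_pair[where 'n='n] d by auto
  \<comment> \<open>The pair of distinct indices keeps the quantified condition from being
    vacuous.\<close>
  with 1 have "(\<forall>r s j k :: 'n. r \<noteq> s \<longrightarrow> j \<noteq> k \<longrightarrow>
      2 * (cmod (v - 1))\<^sup>2 + 2 * Re ((v - 1)\<^sup>2 * cross H r s j k) = (real CARD('n) - 2 + 2 * Re v)\<^sup>2)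
      \<longleftrightarrow> y\<^sup>2 = x\<^sup>2"
    unfolding d by (metis cross_two[OF H d])
  then have "equiangular_conditions H v \<longleftrightarrow> \<bar>x\<^sup>2 + y\<^sup>2 - 1\<bar> = \<bar>2 * x\<bar> \<and> y\<^sup>2 = x\<^sup>2"
    unfolding equiangular_conditions_def by (simp add: d cmod_power2 x_def y_def)
  also have "\<dots> \<longleftrightarrow> (2 * x\<^sup>2 - 1 = 2 * x \<or> 2 * x\<^sup>2 - 1 = - (2 * x)) \<and> y\<^sup>2 = x\<^sup>2"
    by (auto simp: abs_eq_iff)
  also have "2 * x\<^sup>2 - 1 = 2 * x \<longleftrightarrow> x = (1 + sqrt 3) / 2 \<or> x = (1 - sqrt 3) / 2"
  proof -
    have "2 * x\<^sup>2 - 1 - 2 * x = 2 * ((x - (1 + sqrt 3) / 2) * (x - (1 - sqrt 3) / 2))"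
      by (simp add: field_simps power2_eq_square)
    then have "2 * x\<^sup>2 - 1 - 2 * x = 0 \<longleftrightarrow> x - (1 + sqrt 3) / 2 = 0 \<or> x - (1 - sqrt 3) / 2 = 0"
      by (simp only: mult_eq_0_iff) simp
    then show ?thesis by argo
  qed
  also have "2 * x\<^sup>2 - 1 = - (2 * x) \<longleftrightarrow> x = - ((1 + sqrt 3) / 2) \<or> x = - ((1 - sqrt 3) / 2)"
  proof -
    have "2 * x\<^sup>2 - 1 + 2 * x = 2 * ((x + (1 + sqrt 3) / 2) * (x + (1 - sqrt 3) / 2))"
      by (simp add: field_simps power2_eq_square)
    then have "2 * x\<^sup>2 - 1 + 2 * x = 0 \<longleftrightarrow> x + (1 + sqrt 3) / 2 = 0 \<or> x + (1 - sqrt 3) / 2 = 0"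
      by (simp only: mult_eq_0_iff) simp
    then show ?thesis by argo
  qed
  also have "y\<^sup>2 = x\<^sup>2 \<longleftrightarrow> y = x \<or> y = - x"
    by (rule power2_eq_iff)
  also have "((x = (1 + sqrt 3) / 2 \<or> x = (1 - sqrt 3) / 2) \<or>
      x = - ((1 + sqrt 3) / 2) \<or> x = - ((1 - sqrt 3) / 2)) \<and> (y = x \<or> y = - x) \<longleftrightarrow> v \<in> ?S"
    by (simp add: complex_eq_iff flip: x_def y_def) argo
  finally show ?thesis .
qed

lemma equiangular_conditions_three:
  fixes H :: "complex ^ 'n ^ 'n"
  assumes H: "complex_hadamard H" and d: "CARD('n) = 3"
  shows "equiangular_conditions H v \<longleftrightarrow>
    v \<in> {0, -2, 1 + of_real (sqrt 3) * \<i>, 1 - of_real (sqrt 3) * \<i>}"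
proof
  \<comment> \<open>These are the real and imaginary parts of \<open>w = v - 1\<close>, so
    \<open>w\<^sup>2\<close> is real exactly when \<open>a * b = 0\<close>.\<close>
  define a b where "a = Re v - 1" and "b = Im v"
  have norm_v: "(cmod v)\<^sup>2 - 1 = a\<^sup>2 + b\<^sup>2 + 2 * a"
    unfolding cmod_power2 a_def b_def by (simp add: power2_eq_square algebra_simps)
  have norm_w: "(cmod (v - 1))\<^sup>2 = a\<^sup>2 + b\<^sup>2"
    by (simp add: cmod_power2 a_def b_def)
  have Re_w: "Re ((v - 1)\<^sup>2 * z) = (a\<^sup>2 - b\<^sup>2) * Re z - 2 * a * b * Im z" for z
    by (simp add: a_def b_def power2_eq_square)
  have inner: "real CARD('n) - 2 + 2 * Re v = 3 + 2 * a"
    by (simp add: d a_def)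
  obtain r s :: 'n where rs: "r \<noteq> s"
    using ex_neq_pair[where 'n='n] d by auto
  {
    assume "equiangular_conditions H v"
    then have 1: "\<bar>a\<^sup>2 + b\<^sup>2 + 2 * a\<bar> = \<bar>3 + 2 * a\<bar>"
      and 2: "\<And>j k. j \<noteq> k \<Longrightarrow> 2 * (a\<^sup>2 + b\<^sup>2) +
        2 * ((a\<^sup>2 - b\<^sup>2) * Re (cross H r s j k) - 2 * a * b * Im (cross H r s j k)) = (3 + 2 * a)\<^sup>2"
      unfolding equiangular_conditions_def norm_v norm_w Re_w inner using rs by blast+
    define z where "z = cross H r s r s"
    have Re_z: "Re z = -1/2"
      unfolding z_def by (rule Re_cross_three[OF H d rs rs])
    have Im_z: "Im z \<noteq> 0"
      using cmod_cross[OF H, of r s r s] Re_z unfolding z_def[symmetric]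
      by (auto simp: cmod_def power2_eq_square)
    have z1: "2 * (a\<^sup>2 + b\<^sup>2) + 2 * ((a\<^sup>2 - b\<^sup>2) * (-1/2) - 2 * a * b * Im z) = (3 + 2 * a)\<^sup>2"
      using 2[OF rs] Re_z by (simp add: z_def)
    have z2: "2 * (a\<^sup>2 + b\<^sup>2) + 2 * ((a\<^sup>2 - b\<^sup>2) * (-1/2) + 2 * a * b * Im z) = (3 + 2 * a)\<^sup>2"
      using 2[OF rs[symmetric]] Re_z by (simp add: z_def cross_swap_columns[of H r s s r])
    \<comment> \<open>Exchanging the columns conjugates \<open>z\<close>, so only this term changes
      sign between \<open>z1\<close> and \<open>z2\<close>.\<close>
    have "a * b * Im z = 0"
      using z1 z2 by argo
    then have "a = 0 \<or> b = 0"
      using Im_z by simp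
    then show "v \<in> {0, -2, 1 + of_real (sqrt 3) * \<i>, 1 - of_real (sqrt 3) * \<i>}"
    proof
      assume a: "a = 0"
      then have "b\<^sup>2 = 3"
        using 1 by simp
      then have "b\<^sup>2 = (sqrt 3)\<^sup>2"
        by simp
      then have "b = sqrt 3 \<or> b = - sqrt 3"
        by (simp only: power2_eq_iff)
      then show ?thesis
        using a by (auto simp: complex_eq_iff a_def b_def)
    next
      assume b: "b = 0"
      \<comment> \<open>For \<open>b = 0\<close> the mixed condition is
        \<open>a\<^sup>2 = (3 + 2 * a)\<^sup>2\<close>.\<close>
      have "(a + 1) * (a + 3) = 0"
        using z1 b by (simp add: power2_eq_square algebra_simps)
      then have "a = -1 \<or> a = -3"
        by (auto simp: add_eq_0_iff2)
      then show ?thesis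
        using b by (auto simp: complex_eq_iff a_def b_def)
    qed
  }
  assume "v \<in> {0, -2, 1 + of_real (sqrt 3) * \<i>, 1 - of_real (sqrt 3) * \<i>}"
  then have ab: "a = -1 \<and> b = 0 \<or> a = -3 \<and> b = 0 \<or> a = 0 \<and> b = sqrt 3 \<or> a = 0 \<and> b = - sqrt 3"
    by (auto simp: a_def b_def)
  then show "equiangular_conditions H v"
    unfolding equiangular_conditions_def norm_v norm_w Re_w inner
    using Re_cross_three[OF H d] by auto
qed

section \<open>Dimension at least four\<close>

lemma ex_three_others:
  assumes "CARD('n) \<ge> 4"
  obtains j1 j2 j3 :: "'n::finite" where "distinct [k, j1, j2, j3]"
proof -
  have "3 \<le> card (UNIV - {k})"
    using assms by (simp add: card_Diff_singleton)
  then obtain T where "T \<subseteq> UNIV - {k}" "card T = 3"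
    by (meson obtain_subset_with_card_n)
  then show thesis
    using that by (auto simp: card_3_iff)
qed

text \<open>Three unit complex numbers with the same real part cannot be pairwise distinct, so for
  \<open>d \<ge> 4\<close> a constant real part would force two, hence all, columns to agree up to phase.\<close>

lemma Re_cross_not_constant:
  fixes H :: "complex ^ 'n ^ 'n"
  assumes H: "complex_hadamard H" and d: "CARD('n) \<ge> 4" and rs: "r \<noteq> s"
    and const: "\<And>j k. j \<noteq> k \<Longrightarrow> Re (cross H r s j k) = \<rho>"
  shows False
proof -
  fix k :: 'n
  obtain j1 j2 j3 where dist: "distinct [k, j1, j2, j3]"
    using ex_three_others[OF d] .
  define z where "z j = cross H r s j k" for j
  have unit: "z j * cnj (z j) = 1" for j
    by (simp add: z_def unit_mult_cnj cmod_cross[OF H])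
  have Re_z: "Re (z j) = \<rho>" if "j \<noteq> k" for j
    using const[OF that] by (simp add: z_def)
  have Im_z: "(Im (z j))\<^sup>2 = 1 - \<rho>\<^sup>2" if "j \<noteq> k" for j
    using cmod_cross[OF H, of r s j k] Re_z[OF that]
    by (simp add: z_def cmod_def real_sqrt_eq_1_iff)
  \<comment> \<open>Pigeonhole: three imaginary parts with the same square take at most two
    values.\<close>
  have "\<exists>i j. i \<noteq> k \<and> j \<noteq> k \<and> i \<noteq> j \<and> Im (z i) = Im (z j)"
    using Im_z[of j1] Im_z[of j2] Im_z[of j3] dist
    by (metis (no_types, lifting) distinct_length_2_or_more power2_eq_iff)
  then obtain i j where ij: "i \<noteq> k" "j \<noteq> k" "i \<noteq> j" "z i = z j"
    using Re_z by (metis complex_eqI)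
  then have "cross H r s i j = 1"
    using cross_columns_trans[OF H, of r s i k j] unit by (simp add: z_def)
  \<comment> \<open>A unit number with real part 1 equals 1, so every term of the vanishing column
    sum would be 1.\<close>
  then have "\<rho> = 1"
    using const[OF ij(3)] by simp
  then have "z l = 1" for l
    using Re_z[of l] Im_z[of l] cross_same_column[OF H, of r s k]
    by (cases "l = k") (auto simp: z_def complex_eq_iff)
  then show False
    using sum_cross[OF H rs, of k] by (simp add: z_def)
qed

text \<open>The value -1 occurs because the column sum vanishes. The value 1 occurs because, among
  three columns, two must have the same sign relative to a reference column.\<close>

lemma real_cross_both_signs:
  fixes H :: "complex ^ 'n ^ 'n"
  assumes H: "complex_hadamard H" and d: "CARD('n) \<ge> 4" and rs: "r \<noteq> s"
    and pm: "\<And>j k. cross H r s j k \<in> {1, -1}"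
  obtains i j k l where "i \<noteq> j" "cross H r s i j = 1" "k \<noteq> l" "cross H r s k l = -1"
proof -
  fix k :: 'n
  obtain j1 j2 j3 where dist: "distinct [k, j1, j2, j3]"
    using ex_three_others[OF d] .
  have "\<exists>l. cross H r s l k \<noteq> 1"
  proof (rule ccontr)
    assume "\<not> ?thesis"
    then show False
      using sum_cross[OF H rs, of k] by simp
  qed
  then obtain l where l: "cross H r s l k = -1"
    using pm by blast
  then have "l \<noteq> k"
    using cross_same_column[OF H, of r s k] by auto
  moreover have "\<exists>i j. i \<noteq> j \<and> cross H r s i j = 1"
  proof (cases "cross H r s j1 k = 1 \<or> cross H r s j2 k = 1")
    case True
    then show ?thesis using dist by (metis distinct_length_2_or_more)
  next
    case False
    then have "cross H r s j1 k = -1" "cross H r s j2 k = -1"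
      using pm by blast+
    then have "cross H r s j1 j2 = 1"
      using cross_columns_trans[OF H, of r s j1 k j2] by simp
    then show ?thesis using dist by (metis distinct_length_2_or_more)
  qed
  ultimately show thesis
    using that l by blast
qed

lemma equiangular_conditions_ge_four:
  fixes H :: "complex ^ 'n ^ 'n"
  assumes H: "complex_hadamard H" and d: "CARD('n) \<ge> 4" and C: "equiangular_conditions H v"
  shows "CARD('n) = 8 \<and> v \<in> {-1 + 2 * \<i>, -1 - 2 * \<i>} \<and> (\<forall>r s j k. cross H r s j k \<in> {1, -1})"
proof -
  define a b where "a = Re v - 1" and "b = Im v"
  have norm_v: "(cmod v)\<^sup>2 - 1 = a\<^sup>2 + b\<^sup>2 + 2 * a"
    unfolding cmod_power2 a_def b_def by (simp add: power2_eq_square algebra_simps)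
  have norm_w: "(cmod (v - 1))\<^sup>2 = a\<^sup>2 + b\<^sup>2"
    by (simp add: cmod_power2 a_def b_def)
  have Re_w: "Re ((v - 1)\<^sup>2 * z) = (a\<^sup>2 - b\<^sup>2) * Re z - 2 * a * b * Im z" for z
    by (simp add: a_def b_def power2_eq_square)
  define D where "D = real CARD('n)"
  have inner: "real CARD('n) - 2 + 2 * Re v = D + 2 * a"
    by (simp add: D_def a_def)
  have C1: "\<bar>a\<^sup>2 + b\<^sup>2 + 2 * a\<bar> = \<bar>D + 2 * a\<bar>"
    and C2: "\<And>r s j k. r \<noteq> s \<Longrightarrow> j \<noteq> k \<Longrightarrow> 2 * (a\<^sup>2 + b\<^sup>2) +
      2 * ((a\<^sup>2 - b\<^sup>2) * Re (cross H r s j k) - 2 * a * b * Im (cross H r s j k)) = (D + 2 * a)\<^sup>2"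
    using C unfolding equiangular_conditions_def norm_v norm_w Re_w inner by blast+
  have D: "D \<ge> 4"
    using d by (simp add: D_def)
  obtain r s :: 'n where rs: "r \<noteq> s"
    using ex_neq_pair[where 'n='n] d by auto
  \<comment> \<open>Otherwise \<open>w\<^sup>2\<close> is real. It is also nonzero, since
    \<open>w = 0\<close> would turn \<open>C1\<close> into \<open>0 = D\<close>; so the mixed
    condition fixes the real part of all cross values, which is impossible here.\<close>
  have ab: "a * b \<noteq> 0"
  proof
    assume ab: "a * b = 0"
    have ne: "a\<^sup>2 - b\<^sup>2 \<noteq> 0"
    proof
      assume "a\<^sup>2 - b\<^sup>2 = 0"
      then have "a = 0" "b = 0"
        using ab by auto
      then show False
        using C1 D by simp
    qed
    define \<rho> where "\<rho> = ((D + 2 * a)\<^sup>2 - 2 * (a\<^sup>2 + b\<^sup>2)) / (2 * (a\<^sup>2 - b\<^sup>2))"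
    have "Re (cross H r s j k) = \<rho>" if "j \<noteq> k" for j k
    proof -
      have "2 * a * b * Im (cross H r s j k) = 0"
        using ab by auto
      then have "Re (cross H r s j k) * (2 * (a\<^sup>2 - b\<^sup>2)) = (D + 2 * a)\<^sup>2 - 2 * (a\<^sup>2 + b\<^sup>2)"
        using C2[OF rs that] by (simp only:) (simp add: algebra_simps)
      then show ?thesis
        using ne unfolding \<rho>_def by (simp add: nonzero_eq_divide_eq)
    qed
    then show False
      by (rule Re_cross_not_constant[OF H d rs])
  qed
  have pm: "cross H r s j k \<in> {1, -1}" for r s j k
  proof (cases "r = s \<or> j = k")
    case True
    then show ?thesis
      using cross_same_column[OF H] cross_same_row[OF H] by auto
  next
    case False
    then have "r \<noteq> s" "j \<noteq> k" "k \<noteq> j"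
      by auto
    \<comment> \<open>The condition for the exchanged columns involves the conjugate; subtracting
      leaves the imaginary part.\<close>
    then have "a * b * Im (cross H r s j k) = 0"
      using C2[OF \<open>r \<noteq> s\<close> \<open>j \<noteq> k\<close>] C2[OF \<open>r \<noteq> s\<close> \<open>k \<noteq> j\<close>]
      unfolding cross_swap_columns[of H r s k j] cnj.sel by argo
    then have "Im (cross H r s j k) = 0"
      using ab by simp
    moreover from this have "\<bar>Re (cross H r s j k)\<bar> = 1"
      using cmod_cross[OF H, of r s j k] by (simp add: cmod_eq_Re)
    ultimately show ?thesis
      by (auto simp: complex_eq_iff abs_if split: if_splits)
  qed
  obtain i j k l where "i \<noteq> j" "cross H r s i j = 1" "k \<noteq> l" "cross H r s k l = -1"
    using real_cross_both_signs[OF H d rs pm] .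
  \<comment> \<open>Both signs give the same right-hand side, so
    \<open>a\<^sup>2 - b\<^sup>2\<close>, the real part of \<open>w\<^sup>2\<close>, must
    vanish.\<close>
  then have e: "2 * (a\<^sup>2 + b\<^sup>2) + 2 * (a\<^sup>2 - b\<^sup>2) = (D + 2 * a)\<^sup>2"
    "2 * (a\<^sup>2 + b\<^sup>2) - 2 * (a\<^sup>2 - b\<^sup>2) = (D + 2 * a)\<^sup>2"
    using C2[OF rs, of i j] C2[OF rs, of k l] by auto
  then have b: "b\<^sup>2 = a\<^sup>2" and sq: "(D + 2 * a)\<^sup>2 = (2 * a)\<^sup>2"
    by (auto simp: power_mult_distrib)
  \<comment> \<open>The other sign would give \<open>D = 0\<close>.\<close>
  from sq have "D + 2 * a = - (2 * a)"
    using D unfolding power2_eq_iff by auto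
  then have Da: "D = - 4 * a" "a < 0"
    using D by auto
  \<comment> \<open>Substituting \<open>b\<^sup>2 = a\<^sup>2\<close> and \<open>D = - 4 * a\<close>
    into \<open>C1\<close> leaves an equation in \<open>a\<close> whose only negative solution is
    -2, hence \<open>D = 8\<close>.\<close>
  have "\<bar>2 * a\<^sup>2 + 2 * a\<bar> = \<bar>2 * a\<bar>"
    using C1 b Da by simp
  then have "a * (a + 2) = 0 \<or> a * a = 0"
    by (auto simp: abs_eq_iff power2_eq_square algebra_simps)
  then have a: "a = -2"
    using Da(2) by auto
  then have "b\<^sup>2 = 2\<^sup>2"
    using b by simp
  then have "b = 2 \<or> b = -2"
    by (simp only: power2_eq_iff)
  then have "v \<in> {-1 + 2 * \<i>, -1 - 2 * \<i>}"
    using a by (auto simp: complex_eq_iff a_def b_def)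
  moreover have "CARD('n) = 8"
    using Da a by (simp add: D_def)
  ultimately show ?thesis
    using pm by blast
qed

text \<open>Here \<open>w\<^sup>2\<close> is \<open>-8 * \<i>\<close> or \<open>8 * \<i>\<close>, so
  real cross values contribute nothing to the mixed condition, which becomes
  \<open>2 * 8 = 4\<^sup>2\<close>. The first condition is \<open>4 = 4\<close>.\<close>

lemma equiangular_conditions_eight:
  fixes H :: "complex ^ 'n ^ 'n"
  assumes pm: "\<And>r s j k. cross H r s j k \<in> {1, -1}" and d: "CARD('n) = 8"
    and v: "v \<in> {-1 + 2 * \<i>, -1 - 2 * \<i>}"
  shows "equiangular_conditions H v"
proof -
  have "Re ((v - 1)\<^sup>2 * z) = 0" if "z \<in> {1, -1}" for z
    using v that by (auto simp: power2_eq_square)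
  then have "Re ((v - 1)\<^sup>2 * cross H r s j k) = 0" for r s j k
    using pm by blast
  moreover have "(cmod v)\<^sup>2 = 5" "(cmod (v - 1))\<^sup>2 = 8" "Re v = -1"
    using v by (auto simp: cmod_power2)
  ultimately show ?thesis
    by (simp add: equiangular_conditions_def d)
qed

section \<open>Equivalence to a real Hadamard matrix\<close>

lemma diagonal_unitary_norm:
  assumes "diagonal_unitary D"
  shows "cmod (D $ i $ i) = 1"
proof -
  have off: "D $ i $ k = 0" if "k \<noteq> i" for k
    using assms that by (auto simp: diagonal_unitary_def)
  have "(D ** conj_transpose D) $ i $ i = 1"
    using assms by (simp add: diagonal_unitary_def mat_def)
  then have "(\<Sum>k\<in>UNIV. D $ i $ k * cnj (D $ i $ k)) = 1"
    by (simp add: matrix_matrix_mult_def conj_transpose_def)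
  moreover have "(\<Sum>k\<in>UNIV. D $ i $ k * cnj (D $ i $ k)) =
      (\<Sum>k\<in>UNIV. if k = i then D $ i $ i * cnj (D $ i $ i) else 0)"
    by (rule sum.cong) (auto simp: off)
  ultimately have "D $ i $ i * cnj (D $ i $ i) = 1"
    by simp
  then show ?thesis
    by (metis complex_mod_sqrt_Re_mult_cnj one_complex.sel(1) real_sqrt_one)
qed

lemma diagonal_mult_left:
  fixes D A :: "complex ^ 'n ^ 'n"
  assumes "\<And>i j. i \<noteq> j \<Longrightarrow> D $ i $ j = 0"
  shows "(D ** A) $ i $ j = D $ i $ i * A $ i $ j"
proof -
  have "(D ** A) $ i $ j = (\<Sum>k\<in>UNIV. if k = i then D $ i $ i * A $ i $ j else 0)"
    unfolding matrix_matrix_mult_def vec_lambda_beta by (rule sum.cong) (auto simp: assms)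
  then show ?thesis by simp
qed

lemma diagonal_mult_right:
  fixes D A :: "complex ^ 'n ^ 'n"
  assumes "\<And>i j. i \<noteq> j \<Longrightarrow> D $ i $ j = 0"
  shows "(A ** D) $ i $ j = A $ i $ j * D $ j $ j"
proof -
  have "(A ** D) $ i $ j = (\<Sum>k\<in>UNIV. if k = j then A $ i $ j * D $ j $ j else 0)"
    unfolding matrix_matrix_mult_def vec_lambda_beta by (rule sum.cong) (auto simp: assms)
  then show ?thesis by simp
qed

lemma hadamard_equiv_entries:
  fixes H H' :: "complex ^ 'n ^ 'n"
  assumes "hadamard_equiv H H'"
  obtains p q \<alpha> \<beta> where "p permutes UNIV" "q permutes UNIV" "\<And>i. cmod (\<alpha> i) = 1" "\<And>j. cmod (\<beta> j) = 1"
    "\<And>i j. H' $ i $ j = \<alpha> i * H $ p i $ q j * \<beta> j"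
proof -
  obtain D D' p q where D: "diagonal_unitary D" "diagonal_unitary D'"
    and pq: "p permutes UNIV" "q permutes UNIV"
    and H': "H' = D ** (\<chi> i j. if j = p i then 1 else 0) ** H ** (\<chi> i j. if j = q i then 1 else 0) ** D'"
    using assms unfolding hadamard_equiv_def permutation_matrix_def by blast
  have off: "D $ i $ j = 0" "D' $ i $ j = 0" if "i \<noteq> j" for i j
    using D that by (auto simp: diagonal_unitary_def)
  have P: "((\<chi> i j. if j = p i then 1 else 0) ** A) $ i $ j = A $ p i $ j" for A :: "complex ^ 'n ^ 'n" and i j
    by (simp add: matrix_matrix_mult_def if_distrib[of "\<lambda>x. x * _"] cong: if_cong)
  have eq: "j = q k \<longleftrightarrow> k = inv q j" for j k
    using permutes_inv_eq[OF pq(2)] by metis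
  \<comment> \<open>On the right, the permutation matrix sends column \<open>k\<close> to position
    \<open>q k\<close>, so position \<open>j\<close> shows column \<open>inv q j\<close>. This is
    why the inverse is the witness below.\<close>
  have Q: "(A ** (\<chi> i j. if j = q i then 1 else 0)) $ i $ j = A $ i $ inv q j" for A :: "complex ^ 'n ^ 'n" and i j
    by (simp add: matrix_matrix_mult_def eq if_distrib[of "\<lambda>x. _ * x"] cong: if_cong)
  have "H' $ i $ j = D $ i $ i * H $ p i $ inv q j * D' $ j $ j" for i j
    unfolding H' by (simp add: diagonal_mult_right[OF off(2)] Q diagonal_mult_left[OF off(1)] P
        flip: matrix_mul_assoc[of D] matrix_mul_assoc[of _ H])
  then show thesis
    using that[of p "inv q" "\<lambda>i. D $ i $ i" "\<lambda>j. D' $ j $ j"] pq permutes_inv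
      diagonal_unitary_norm D by blast
qed

text \<open>The permutations only rename indices, and each phase of a row or column meets its own
  conjugate in the cross product. The value is therefore a product of entries of \<open>H'\<close>,
  all of them signs.\<close>

lemma real_hadamard_equiv_imp_cross:
  assumes "real_hadamard H'" "hadamard_equiv H H'"
  shows "cross H r s j k \<in> {1, -1}"
proof -
  obtain p q \<alpha> \<beta> where pq: "p permutes UNIV" "q permutes UNIV"
    and un: "\<And>i. cmod (\<alpha> i) = 1" "\<And>j. cmod (\<beta> j) = 1"
    and H': "\<And>i j. H' $ i $ j = \<alpha> i * H $ p i $ q j * \<beta> j"
    using hadamard_equiv_entries[OF assms(2)] by metis
  obtain r' s' j' k' where idx: "r = p r'" "s = p s'" "j = q j'" "k = q k'"
    using permutes_surj[OF pq(1)] permutes_surj[OF pq(2)] by (metis surjD)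
  have "cross H' r' s' j' k' = cross H r s j k"
    unfolding cross_def H' idx complex_cnj_mult
    using unit_mult_cnj[OF un(1), of r'] unit_mult_cnj[OF un(1), of s']
      unit_mult_cnj[OF un(2), of j'] unit_mult_cnj[OF un(2), of k'] by algebra
  moreover have "H' $ a $ b \<in> {1, -1}" for a b
    using assms(1) by (auto simp: real_hadamard_def)
  then have "cross H' r' s' j' k' \<in> {1, -1}"
    unfolding cross_def by (smt (verit) complex_cnj_minus complex_cnj_one empty_iff insert_iff
        minus_minus mult.left_neutral mult_minus1)
  ultimately show ?thesis by simp
qed

lemma diagonal_unitary_diag:
  assumes "\<And>i. cmod (f i) = 1"
  shows "diagonal_unitary (\<chi> i j. if i = j then f i else 0)"
proof -
  have "(\<chi> i j. if i = j then f i else 0) ** conj_transpose (\<chi> i j. if i = j then f i else 0) = mat 1"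
    by (auto simp: vec_eq_iff diagonal_mult_left conj_transpose_def mat_def
        unit_mult_cnj[OF assms])
  moreover have "conj_transpose (\<chi> i j. if i = j then f i else 0) ** (\<chi> i j. if i = j then f i else 0) = mat 1"
    by (auto simp: vec_eq_iff diagonal_mult_right conj_transpose_def mat_def
        unit_mult_cnj[OF assms] mult.commute[of "cnj _"])
  ultimately show ?thesis
    by (simp add: diagonal_unitary_def)
qed

lemma permutation_matrix_1: "permutation_matrix (mat 1)"
  unfolding permutation_matrix_def mat_def
  by (intro exI[of _ id]) (auto simp: permutes_id vec_eq_iff)

text \<open>Dephasing \<open>H\<close> at row \<open>i\<close> and column \<open>i\<close> makes
  that row and column all ones and turns the entries into cross values, which are signs.
  \<open>D\<close> removes the phases of column \<open>i\<close>, \<open>D'\<close> those of row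
  \<open>i\<close> up to the common factor \<open>H $ i $ i\<close>.\<close>

lemma cross_imp_real_hadamard_equiv:
  fixes H :: "complex ^ 'n ^ 'n"
  assumes H: "complex_hadamard H" and pm: "\<And>r s j k. cross H r s j k \<in> {1, -1}"
  shows "\<exists>H'. real_hadamard H' \<and> hadamard_equiv H H'"
proof -
  fix i :: 'n
  define H' :: "complex ^ 'n ^ 'n" where "H' = (\<chi> r j. cross H r i j i)"
  define D :: "complex ^ 'n ^ 'n" where "D = (\<chi> r j. if r = j then cnj (H $ r $ i) else 0)"
  define D' :: "complex ^ 'n ^ 'n" where
    "D' = (\<chi> r j. if r = j then cnj (H $ i $ r) * H $ i $ i else 0)"
  \<comment> \<open>By \<open>cross_rows_trans\<close>, entry \<open>(r, s)\<close> of the product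
    is the sum over \<open>j\<close> of \<open>cross H r s j i\<close>.\<close>
  have "H' ** conj_transpose H' = mat (of_nat CARD('n))"
    using sum_cross[OF H, of _ _ i]
    by (auto simp: vec_eq_iff matrix_matrix_mult_def conj_transpose_def mat_def H'_def
        cross_rows_trans[OF H] cross_same_row[OF H])
  moreover have "cmod (H' $ r $ j) = 1" for r j
    by (simp add: H'_def cmod_cross[OF H])
  ultimately have "real_hadamard H'"
    using pm by (simp add: real_hadamard_def complex_hadamard_def) (simp add: H'_def)
  moreover have "diagonal_unitary D" "diagonal_unitary D'"
    unfolding D_def D'_def
    by (rule diagonal_unitary_diag; simp add: norm_mult hadamard_norm[OF H])+
  moreover have "H' = D ** mat 1 ** H ** mat 1 ** D'"
  proof -
    have "(D ** H ** D') $ r $ j = H' $ r $ j" for r j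
      by (subst diagonal_mult_right, simp add: D'_def, subst diagonal_mult_left, simp add: D_def)
        (simp add: D_def D'_def H'_def cross_def mult_ac)
    then show ?thesis
      by (simp add: vec_eq_iff)
  qed
  ultimately show ?thesis
    unfolding hadamard_equiv_def using permutation_matrix_1 by blast
qed

section \<open>The classification by dimension\<close>

theorem theorem3p1:
  fixes H :: "complex ^ 'n ^ 'n" and v :: complex
  assumes "CARD('n) \<ge> 2" and "complex_hadamard H"
  shows "equiangular_lines (CARD('n)\<^sup>2) (hadamard_vecs H v) \<longleftrightarrow>
    (CARD('n) = 2 \<and>
       v \<in> {1/2 * (1 + of_real (sqrt 3)) * (1 + \<i>), 1/2 * (1 - of_real (sqrt 3)) * (1 + \<i>),
            1/2 * (1 + of_real (sqrt 3)) * (1 - \<i>), 1/2 * (1 - of_real (sqrt 3)) * (1 - \<i>),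
            - (1/2) * (1 + of_real (sqrt 3)) * (1 + \<i>), - (1/2) * (1 - of_real (sqrt 3)) * (1 + \<i>),
            - (1/2) * (1 + of_real (sqrt 3)) * (1 - \<i>), - (1/2) * (1 - of_real (sqrt 3)) * (1 - \<i>)}) \<or>
    (CARD('n) = 3 \<and> v \<in> {0, -2, 1 + of_real (sqrt 3) * \<i>, 1 - of_real (sqrt 3) * \<i>}) \<or>
    (CARD('n) = 8 \<and> (\<exists>H'. real_hadamard H' \<and> hadamard_equiv H H') \<and> v \<in> {-1 + 2 * \<i>, -1 - 2 * \<i>})"
    (is "_ \<longleftrightarrow> ?A \<or> ?B \<or> ?C")
proof -
  consider "CARD('n) = 2" | "CARD('n) = 3" | "CARD('n) \<ge> 4"
    using assms(1) by linarith
  then have "equiangular_conditions H v \<longleftrightarrow> ?A \<or> ?B \<or> ?C"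
  proof cases
    case 1
    then show ?thesis
      using equiangular_conditions_two[OF assms(2)] by simp
  next
    case 2
    then show ?thesis
      using equiangular_conditions_three[OF assms(2)] by simp
  next
    case 3
    then have "equiangular_conditions H v \<longleftrightarrow> ?C"
      using equiangular_conditions_ge_four[OF assms(2)] cross_imp_real_hadamard_equiv[OF assms(2)]
        equiangular_conditions_eight real_hadamard_equiv_imp_cross by metis
    with 3 show ?thesis by auto
  qed
  then show ?thesis
    by (simp only: equiangular_lines_iff[OF assms])
qed

end
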